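(* For any fixed $\varepsilon>0$ and $\delta>0$ there exists $\kappa>0$ such that the following holds. Let $P$ and $N$ be sufficiently large positive integers with $P^{\varepsilon}\le N\le P^2$, and for every prime $p$ with $P<p\le 2P$ let $N_p$ be an integer with $N<N_p\le 2N$. Then for all primes $p$ with $P<p\le 2P$, except for $O(P^{1/2+\delta})$ of them, we have $$ \max_{\gcd(a,p)=1}|S_p(a;N_p)|\le N_p\,p^{-\kappa}. $$ The implied constant in $O(P^{1/2+\delta})$ depends only on $\varepsilon$ and $\delta$.
   Context: For a prime $p$ and an integer $u$ with $\gcd(u,p)=1$, the Fermat quotient $q_p(u)$ is the unique integer with $q_p(u)\equiv \frac{u^{p-1}-1}{p}\pmod p$ and $0\le q_p(u)\le p-1$. For an integer $a$ and a positive integer $M$, $$S_p(a;M)=\sum_{\substack{1\le n\le M\\ \gcd(n,p)=1}}\exp\left(2\pi i\, a\, q_p(n)/p\right).$$ The maximum is over integers $a$ with $\gcd(a,p)=1$. The set of exceptional primes may depend on $N$ and on the sequence $(N_p)$. *)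

theory Defs
  imports "HOL-Analysis.Analysis" "HOL-Number_Theory.Number_Theory"
begin

text \<open>The division by \<open>p\<close> is exact when \<open>p\<close> is prime and coprime to \<open>u\<close>; see
  \<open>fermat_quotient_div_exact\<close> below.\<close>

definition fermat_quotient :: "nat \<Rightarrow> int \<Rightarrow> int" where
  "fermat_quotient p u =
     (THE q. [q = (u ^ (p - 1) - 1) div int p] (mod int p) \<and> 0 \<le> q \<and> q \<le> int p - 1)"

definition fermat_sum :: "nat \<Rightarrow> int \<Rightarrow> nat \<Rightarrow> complex" where
  "fermat_sum p a M =
     (\<Sum>n | n \<in> {1..M} \<and> coprime n p.
        exp (2 * of_real pi * \<i> * of_int a * of_int (fermat_quotient p (int n)) / of_nat p))"

text \<open>The maximum is taken over the set of values of the modulus, which is finite because the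
  sum depends only on \<open>a\<close> modulo \<open>p\<close> (see \<open>finite_fermat_sum_values\<close> below).\<close>

definition max_fermat_sum :: "nat \<Rightarrow> nat \<Rightarrow> real" where
  "max_fermat_sum p M = Max ((\<lambda>a. norm (fermat_sum p a M)) ` {a :: int. coprime a (int p)})"

lemma fermat_quotient_div_exact:
  assumes "prime p" "coprime u (int p)"
  shows "int p * ((u ^ (p - 1) - 1) div int p) = u ^ (p - 1) - 1"
proof -
  define v where "v = nat (u mod int p)"
  have p: "p > 0" using assms(1) by (rule prime_gt_0_nat)
  then have v: "int v = u mod int p" by (simp add: v_def)
  have "coprime (int v) (int p)"
    unfolding v using assms(2) p by (simp add: coprime_commute)
  then have "[v ^ totient p = 1] (mod p)" by (intro euler_theorem) simp
  then have "[int v ^ (p - 1) = 1] (mod int p)"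
    using assms(1) by (metis cong_int_iff of_nat_1 of_nat_power totient_prime)
  moreover have "[u ^ (p - 1) = int v ^ (p - 1)] (mod int p)"
    unfolding v by (intro cong_pow) (simp add: cong_def)
  ultimately have "[u ^ (p - 1) = 1] (mod int p)" by (rule cong_trans[rotated])
  then show ?thesis by (simp add: cong_iff_dvd_diff)
qed

lemma fermat_quotient_eq_mod:
  assumes "p > 0"
  shows "fermat_quotient p u = ((u ^ (p - 1) - 1) div int p) mod int p"
  unfolding fermat_quotient_def
proof (rule the_equality)
  show "[(u ^ (p - 1) - 1) div int p mod int p = (u ^ (p - 1) - 1) div int p] (mod int p) \<and>
        0 \<le> (u ^ (p - 1) - 1) div int p mod int p \<and>
        (u ^ (p - 1) - 1) div int p mod int p \<le> int p - 1"
    using assms by (simp add: cong_def)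
next
  fix q assume "[q = (u ^ (p - 1) - 1) div int p] (mod int p) \<and> 0 \<le> q \<and> q \<le> int p - 1"
  then have "q mod int p = (u ^ (p - 1) - 1) div int p mod int p" "0 \<le> q" "q < int p"
    by (auto simp: cong_def)
  then show "q = (u ^ (p - 1) - 1) div int p mod int p"
    by (metis mod_pos_pos_trivial)
qed

lemma fermat_sum_mod:
  assumes "p > 0"
  shows "fermat_sum p (a mod int p) M = fermat_sum p a M"
  unfolding fermat_sum_def
proof (rule sum.cong)
  fix n
  define q where "q = fermat_quotient p (int n)"
  define d where "d = a div int p"
  have "a = a mod int p + d * int p" by (simp add: d_def)
  then have a: "(of_int a :: complex) = of_int (a mod int p) + of_int d * of_nat p"
    by (metis of_int_add of_int_mult of_int_of_nat_eq)
  have "2 * of_real pi * \<i> * of_int a * of_int q / of_nat p =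
      2 * of_real pi * \<i> * of_int (a mod int p) * of_int q / of_nat p
      + complex_of_int (d * q) * (of_real pi * 2) * \<i>"
    unfolding a using assms by (simp add: field_simps)
  moreover have "exp (complex_of_int (d * q) * (of_real pi * 2) * \<i>) = 1"
    using exp_integer_2pi[of "of_int (d * q)"] by (simp add: mult_ac)
  ultimately show
    "exp (2 * of_real pi * \<i> * of_int (a mod int p) * of_int (fermat_quotient p (int n)) / of_nat p) =
     exp (2 * of_real pi * \<i> * of_int a * of_int (fermat_quotient p (int n)) / of_nat p)"
    unfolding q_def[symmetric] by (metis exp_add mult.right_neutral)
qed simp

lemma finite_fermat_sum_values:
  assumes "p > 0"
  shows "finite ((\<lambda>a. norm (fermat_sum p a M)) ` {a :: int. coprime a (int p)})"
proof (rule finite_subset)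
  show "(\<lambda>a. norm (fermat_sum p a M)) ` {a. coprime a (int p)}
          \<subseteq> (\<lambda>a. norm (fermat_sum p a M)) ` {0..<int p}"
  proof (rule image_subsetI)
    fix a :: int
    have "norm (fermat_sum p a M) = norm (fermat_sum p (a mod int p) M)"
      using assms by (simp add: fermat_sum_mod)
    moreover have "a mod int p \<in> {0..<int p}" using assms by simp
    ultimately show "norm (fermat_sum p a M) \<in> (\<lambda>a. norm (fermat_sum p a M)) ` {0..<int p}"
      by blast
  qed
qed simp

end

theory Submission
  imports Defs
begin

text \<open>The map \<open>n \<mapsto> exp (2 \<pi> i a q\<^sub>p(n) / p)\<close> is a nontrivial Dirichlet character \<open>\<psi>\<^sub>p\<close> modulo \<open>p\<^sup>2\<close>.
  Fix \<open>k\<close> with \<open>k \<epsilon> \<ge> 6\<close>. The \<open>k\<close>-th power of a sum of length \<open>M\<close> is a character sum of length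
  \<open>X = M\<^sup>k\<close>, weighted by the number of factorisations into \<open>k\<close> factors. By duality, large values at
  many primes are controlled by the sums over \<open>n \<le> X\<close> of \<open>\<psi>\<^sub>p\<close> times the conjugate of \<open>\<psi>\<^sub>q\<close>. For
  \<open>p \<noteq> q\<close> these are at most the period \<open>p\<^sup>2 q\<^sup>2 \<le> 16 P\<^sup>4\<close>, which is negligible against \<open>X\<close>. With the
  divisor bound for the weights, the number of exceptional primes is at most a power of \<open>P\<close> whose
  exponent tends to 0 with \<open>\<kappa>\<close>.\<close>

section \<open>The divisor bound\<close>

text \<open>A divisor is determined by its exponents at the primes of \<open>n\<close>, none of
  which exceeds the exponent in \<open>n\<close>; so the divisors inject into a box of exponent
  vectors.\<close>

lemma card_divisors_le_prod:
  fixes n :: nat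
  assumes "n > 0"
  shows "card {d. d dvd n} \<le> (\<Prod>p\<in>prime_factors n. Suc (multiplicity p n))"
proof -
  define S where "S = PiE (prime_factors n) (\<lambda>p. {..multiplicity p n})"
  define \<phi> where "\<phi> d = restrict (\<lambda>p. multiplicity p d) (prime_factors n)" for d :: nat
  have "card {d. d dvd n} \<le> card S"
  proof (rule card_inj_on_le)
    show "inj_on \<phi> {d. d dvd n}"
    proof (rule inj_onI)
      fix d e assume d: "d \<in> {d. d dvd n}" "e \<in> {d. d dvd n}" and eq: "\<phi> d = \<phi> e"
      have "multiplicity p d = multiplicity p e" if "prime p" for p
      proof (cases "p dvd n")
        case True
        then have "p \<in> prime_factors n" using assms that by (simp add: prime_factors_dvd)
        then show ?thesis using fun_cong[OF eq, of p] by (simp add: \<phi>_def)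
      next
        case False
        then have "\<not> p dvd d" "\<not> p dvd e" using d by (auto dest: dvd_trans)
        then show ?thesis by (simp add: not_dvd_imp_multiplicity_0)
      qed
      moreover have "d > 0" "e > 0" using d assms by (auto intro: Nat.gr0I)
      ultimately show "d = e" by (blast intro: multiplicity_eq_nat)
    qed
    show "\<phi> ` {d. d dvd n} \<subseteq> S"
      using assms by (auto simp: \<phi>_def S_def intro!: dvd_imp_multiplicity_le)
    show "finite S" by (auto simp: S_def intro: finite_PiE)
  qed
  also have "card S = (\<Prod>p\<in>prime_factors n. Suc (multiplicity p n))"
    by (simp add: S_def card_PiE)
  finally show ?thesis .
qed

text \<open>The exponent factors \<open>m + 1\<close> are compared with
  \<open>p powr (\<eta> * m)\<close> prime by prime. For \<open>p\<close> at least
  \<open>2 powr (1 / \<eta>)\<close> the latter is at least \<open>2 ^ m\<close>, hence at least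
  \<open>m + 1\<close>; each smaller prime loses at most a factor \<open>A\<close>, so
  \<open>A ^ T\<close> is a uniform constant.\<close>

lemma card_divisors_le_powr:
  fixes \<eta> :: real
  assumes "\<eta> > 0"
  obtains C where "C \<ge> 1" "\<And>n::nat. n > 0 \<Longrightarrow> real (card {d. d dvd n}) \<le> C * real n powr \<eta>"
proof -
  define T where "T = nat \<lceil>2 powr (1 / \<eta>)\<rceil>"
  \<comment> \<open>Chosen so that \<open>A * \<eta> * ln 2\<close> is at least 1: the linear lower
    bound for \<open>exp (\<eta> * ln 2 * m)\<close>, multiplied by \<open>A\<close>, then dominates
    \<open>m + 1\<close>.\<close>
  define A where "A = max 1 (1 / (\<eta> * ln 2))"
  have A: "A \<ge> 1" "1 / (\<eta> * ln 2) \<le> A" by (auto simp: A_def)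
  \<comment> \<open>Only the primes below the constant \<open>2 powr (1 / \<eta>)\<close> can contribute a factor exceeding 1.\<close>
  define c where "c p = (if p < T then A else 1)" for p :: nat
  have c1: "c p \<ge> 1" for p using A by (simp add: c_def)
  have local: "real (Suc m) \<le> c p * real p powr (\<eta> * real m)" if "prime p" for p m
  proof (cases "p < T")
    case True
    have "1 + \<eta> * ln 2 * real m \<le> exp (\<eta> * ln 2 * real m)" by (rule exp_ge_add_one_self)
    also have "\<dots> = 2 powr (\<eta> * real m)" by (simp add: powr_def mult_ac)
    also have "\<dots> \<le> real p powr (\<eta> * real m)"
      using prime_ge_2_nat[OF that] assms by (intro powr_mono2) auto
    finally have 1: "1 + \<eta> * ln 2 * real m \<le> real p powr (\<eta> * real m)" .
    have "1 \<le> A * (\<eta> * ln 2)" using A(2) assms by (simp add: field_simps)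
    then have "1 * real m \<le> A * (\<eta> * ln 2) * real m" by (rule mult_right_mono) simp
    then have "real (Suc m) \<le> A * (1 + \<eta> * ln 2 * real m)"
      using A(1) by (simp add: algebra_simps)
    also have "\<dots> \<le> A * real p powr (\<eta> * real m)"
      using 1 A(1) by (intro mult_left_mono) auto
    finally show ?thesis using True by (simp add: c_def)
  next
    case False
    have "real (Suc m) \<le> 2 ^ m"
      using less_exp[of m] by (metis Suc_leI of_nat_le_iff of_nat_numeral of_nat_power)
    also have "\<dots> = (2 powr (1 / \<eta>)) powr (\<eta> * real m)"
      using assms by (simp add: powr_powr powr_realpow)
    also have "\<dots> \<le> real p powr (\<eta> * real m)"
      using False assms unfolding T_def by (intro powr_mono2) (auto, linarith)
    finally show ?thesis using False by (simp add: c_def)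
  qed
  show ?thesis
  proof
    show "A ^ T \<ge> 1" using A by simp
    fix n :: nat assume n: "n > 0"
    have "real (card {d. d dvd n}) \<le> (\<Prod>p\<in>prime_factors n. real (Suc (multiplicity p n)))"
      using card_divisors_le_prod[OF n] by (metis of_nat_le_iff of_nat_prod)
    also have "\<dots> \<le> (\<Prod>p\<in>prime_factors n. c p * real p powr (\<eta> * real (multiplicity p n)))"
      by (intro prod_mono conjI local) auto
    also have "\<dots> = (\<Prod>p\<in>prime_factors n. c p)
        * (\<Prod>p\<in>prime_factors n. real p powr (\<eta> * real (multiplicity p n)))"
      by (rule prod.distrib)
    also have "(\<Prod>p\<in>prime_factors n. real p powr (\<eta> * real (multiplicity p n)))
        = (\<Prod>p\<in>prime_factors n. real (p ^ multiplicity p n)) powr \<eta>"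
    proof (unfold prod_powr_distrib)
      show "(\<Prod>p\<in>prime_factors n. real p powr (\<eta> * real (multiplicity p n)))
          = (\<Prod>p\<in>prime_factors n. real (p ^ multiplicity p n) powr \<eta>)"
      proof (rule prod.cong)
        fix p assume "p \<in> prime_factors n"
        then have "real p > 0" by (auto intro!: prime_gt_0_nat)
        then show "real p powr (\<eta> * real (multiplicity p n)) = real (p ^ multiplicity p n) powr \<eta>"
          by (simp add: powr_realpow[symmetric] powr_powr mult.commute)
      qed simp
    qed
    also have "(\<Prod>p\<in>prime_factors n. real (p ^ multiplicity p n)) = real n"
      using prime_factorization_nat[OF n] by (metis of_nat_prod)
    \<comment> \<open>Since every \<open>c p\<close> is at least 1, all numbers below
      \<open>T\<close> may be added to the index set; \<open>c p = 1\<close> from \<open>T\<close>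
      onwards then removes the dependence on \<open>n\<close>.\<close>
    also have "(\<Prod>p\<in>prime_factors n. c p) \<le> (\<Prod>p\<in>prime_factors n \<union> {..<T}. c p)"
      by (rule prod_mono2) (auto intro: c1 order_trans[OF zero_le_one])
    also have "\<dots> = (\<Prod>p\<in>{..<T}. c p)"
      by (rule prod.mono_neutral_right) (auto simp: c_def)
    also have "\<dots> = A ^ T" by (simp add: c_def)
    finally show "real (card {d. d dvd n}) \<le> A ^ T * real n powr \<eta>"
      by (simp add: mult_right_mono)
  qed
qed

section \<open>Incomplete sums of nontrivial characters\<close>

lemma periodic_add_mult:
  fixes f :: "nat \<Rightarrow> 'a"
  assumes "\<And>n. f (n + m) = f n"
  shows "f (n + k * m) = f n"
proof (induction k)
  case (Suc k)
  have "n + Suc k * m = n + k * m + m" by simp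
  then show ?case using assms[of "n + k * m"] Suc by metis
qed simp

lemma periodic_mod:
  fixes f :: "nat \<Rightarrow> 'a"
  assumes "\<And>n. f (n + m) = f n"
  shows "f (n mod m) = f n"
  using periodic_add_mult[of f m "n mod m" "n div m", OF assms] by simp

text \<open>Multiplication by the unit \<open>u\<close> permutes the residues modulo
  \<open>m\<close>, so the sum equals \<open>\<psi> u\<close> times itself, with
  \<open>\<psi> u\<close> different from 1.\<close>

lemma nontrivial_character_sum_period:
  fixes \<psi> :: "nat \<Rightarrow> 'a :: idom"
  assumes mult: "\<And>x y. \<psi> (x * y) = \<psi> x * \<psi> y" and per: "\<And>n. \<psi> (n + m) = \<psi> n"
    and u: "coprime u m" "\<psi> u \<noteq> 1" and m: "m > 0"
  shows "(\<Sum>n<m. \<psi> n) = 0"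
proof -
  have inj: "inj_on (\<lambda>n. u * n mod m) {..<m}"
  proof (rule inj_onI)
    fix x y assume "x \<in> {..<m}" "y \<in> {..<m}" and "u * x mod m = u * y mod m"
    then have "[x = y] (mod m)" using cong_mult_lcancel_nat[OF u(1), of x y] by (simp add: cong_def)
    with \<open>x \<in> {..<m}\<close> \<open>y \<in> {..<m}\<close> show "x = y" by (simp add: cong_def)
  qed
  have im: "(\<lambda>n. u * n mod m) ` {..<m} = {..<m}"
    by (rule endo_inj_surj) (use m inj in auto)
  have "(\<Sum>n<m. \<psi> n) = (\<Sum>n<m. \<psi> (u * n mod m))"
    using sum.reindex[OF inj, of \<psi>] by (simp add: im o_def)
  also have "\<dots> = \<psi> u * (\<Sum>n<m. \<psi> n)"
    by (simp add: periodic_mod[of \<psi>, OF per] mult sum_distrib_left)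
  finally show ?thesis using u(2) by (metis mult_cancel_right1)
qed

text \<open>Complete periods cancel, and fewer than \<open>m\<close> terms of norm at most 1
  remain.\<close>

lemma nontrivial_character_sum_bound:
  fixes \<psi> :: "nat \<Rightarrow> 'a :: real_normed_field"
  assumes mult: "\<And>x y. \<psi> (x * y) = \<psi> x * \<psi> y" and per: "\<And>n. \<psi> (n + m) = \<psi> n"
    and u: "coprime u m" "\<psi> u \<noteq> 1" and m: "m > 0" and norm: "\<And>n. norm (\<psi> n) \<le> 1"
  shows "norm (\<Sum>n=1..X. \<psi> n) \<le> real m"
proof -
  define Y q r where "Y = Suc X" and "q = Y div m" and "r = Y mod m"
  have Y: "Y = q * m + r" by (simp add: q_def r_def)
  have shift: "sum \<psi> {k * m..<k * m + j} = (\<Sum>n<j. \<psi> n)" for k j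
    using sum.shift_bounds_nat_ivl[of \<psi> 0 "k * m" j]
    by (simp add: periodic_add_mult[of \<psi>, OF per] add.commute[of "k * m"] atLeast0LessThan)
  \<comment> \<open>The value at 0 vanishes, so the sum may start at 0 and be cut into blocks
    aligned with the period.\<close>
  have "\<psi> 0 = \<psi> 0 * \<psi> u" using mult[of 0 u] by simp
  then have "\<psi> 0 = 0" using u(2) by (metis mult_cancel_left1)
  then have "(\<Sum>n=1..X. \<psi> n) = (\<Sum>n<Y. \<psi> n)"
    by (intro sum.mono_neutral_left) (auto simp: Y_def Suc_le_eq)
  also have "\<dots> = sum \<psi> {..<q * m} + sum \<psi> {q * m..<q * m + r}"
    unfolding Y lessThan_atLeast0 by (rule sum.atLeastLessThan_concat[symmetric]) auto
  also have "sum \<psi> {..<q * m} = 0"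
    unfolding sum.nat_group[symmetric]
    by (simp add: shift nontrivial_character_sum_period[of \<psi>, OF mult per u m])
  also have "sum \<psi> {q * m..<q * m + r} = (\<Sum>n<r. \<psi> n)" by (rule shift)
  finally have "norm (\<Sum>n=1..X. \<psi> n) = norm (\<Sum>n<r. \<psi> n)" by simp
  also have "\<dots> \<le> (\<Sum>n<r. 1)" by (intro sum_norm_le norm)
  also have "\<dots> \<le> real m" using m by (simp add: r_def less_imp_le)
  finally show ?thesis .
qed

section \<open>Large values by duality\<close>

text \<open>The large sums are added with phases that make them positive, the order of summation is
  exchanged, and Cauchy-Schwarz separates the weights from the functions. Expanding the remaining
  square leaves only correlations of pairs: the diagonal ones are at most \<open>card A\<close>, the
  others at most \<open>D\<close>.\<close>

lemma duality_large_values: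
  fixes \<psi> :: "'p \<Rightarrow> 'n \<Rightarrow> complex" and w :: "'n \<Rightarrow> real"
  assumes fin: "finite B"
    and norm: "\<And>p n. p \<in> B \<Longrightarrow> norm (\<psi> p n) \<le> 1"
    and orth: "\<And>p q. p \<in> B \<Longrightarrow> q \<in> B \<Longrightarrow> p \<noteq> q \<Longrightarrow> norm (\<Sum>n\<in>A. \<psi> p n * cnj (\<psi> q n)) \<le> D"
    and D: "D \<ge> 0"
    and large: "\<And>p. p \<in> B \<Longrightarrow> V \<le> norm (\<Sum>n\<in>A. w n * \<psi> p n)" and V: "V \<ge> 0"
  shows "real (card B) * V\<^sup>2 \<le> (\<Sum>n\<in>A. (w n)\<^sup>2) * (real (card A) + real (card B) * D)"
proof (cases "B = {}")
  case True
  then show ?thesis by (simp add: sum_nonneg)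
next
  case False
  then have b: "real (card B) > 0" using fin by (simp add: card_gt_0_iff)
  define S where "S p = (\<Sum>n\<in>A. w n * \<psi> p n)" for p
  \<comment> \<open>The phase that rotates \<open>S p\<close> onto its norm; it is 0 when
    \<open>S p\<close> is 0.\<close>
  define \<theta> where "\<theta> p = cnj (sgn (S p))" for p
  have \<theta>: "norm (\<theta> p) \<le> 1" for p by (simp add: \<theta>_def norm_sgn)
  have \<theta>S: "\<theta> p * S p = norm (S p)" for p
    using complex_norm_square[of "S p"]
    by (cases "S p = 0") (simp_all add: \<theta>_def sgn_eq power2_eq_square field_simps)
  define g where "g n = (\<Sum>p\<in>B. \<theta> p * \<psi> p n)" for n
  have "real (card B) * V \<le> (\<Sum>p\<in>B. norm (S p))"
    using sum_mono[of B "\<lambda>_. V" "\<lambda>p. norm (S p)"] large by (simp add: S_def)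
  also have "\<dots> = Re (\<Sum>p\<in>B. \<theta> p * S p)" by (simp add: \<theta>S)
  also have "(\<Sum>p\<in>B. \<theta> p * S p) = (\<Sum>n\<in>A. w n * g n)"
    unfolding S_def g_def sum_distrib_left by (subst sum.swap) (simp add: mult_ac)
  also have "Re \<dots> \<le> norm (\<Sum>n\<in>A. w n * g n)" by (rule complex_Re_le_cmod)
  also have "\<dots> \<le> (\<Sum>n\<in>A. \<bar>w n\<bar> * norm (g n))"
    by (rule sum_norm_le) (simp add: norm_mult)
  finally have "(real (card B) * V)\<^sup>2 \<le> (\<Sum>n\<in>A. \<bar>w n\<bar> * norm (g n))\<^sup>2"
    using V by (intro power_mono) auto
  also have "\<dots> \<le> (\<Sum>n\<in>A. \<bar>w n\<bar>\<^sup>2) * (\<Sum>n\<in>A. (norm (g n))\<^sup>2)"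
    by (rule Cauchy_Schwarz_ineq_sum)
  also have "(\<Sum>n\<in>A. (norm (g n))\<^sup>2) \<le>
      real (card B) * (real (card A) + real (card B) * D)"
  proof -
    have "complex_of_real (\<Sum>n\<in>A. (norm (g n))\<^sup>2) = (\<Sum>n\<in>A. g n * cnj (g n))"
      by (simp only: of_real_sum complex_norm_square)
    also have "\<dots> = (\<Sum>n\<in>A. \<Sum>p\<in>B. \<Sum>q\<in>B. \<theta> p * \<psi> p n * cnj (\<theta> q * \<psi> q n))"
      by (simp add: g_def sum_product)
    also have "\<dots> = (\<Sum>p\<in>B. \<Sum>q\<in>B. \<Sum>n\<in>A. \<theta> p * \<psi> p n * cnj (\<theta> q * \<psi> q n))"
      by (subst sum.swap, rule sum.cong[OF refl], rule sum.swap)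
    also have "\<dots> = (\<Sum>p\<in>B. \<Sum>q\<in>B. \<theta> p * cnj (\<theta> q) * (\<Sum>n\<in>A. \<psi> p n * cnj (\<psi> q n)))"
      by (simp add: sum_distrib_left mult_ac)
    finally have eq: "complex_of_real (\<Sum>n\<in>A. (norm (g n))\<^sup>2) = \<dots>" .
    \<comment> \<open>\<open>D\<close> is added on the diagonal too, so that the double sum has a
      simple closed form.\<close>
    have pair: "norm (\<theta> p * cnj (\<theta> q) * (\<Sum>n\<in>A. \<psi> p n * cnj (\<psi> q n)))
        \<le> (if p = q then real (card A) else 0) + D" if "p \<in> B" "q \<in> B" for p q
    proof -
      have "norm (\<Sum>n\<in>A. \<psi> p n * cnj (\<psi> q n)) \<le> (if p = q then real (card A) else 0) + D"
      proof (cases "p = q")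
        case True
        have "norm (\<Sum>n\<in>A. \<psi> p n * cnj (\<psi> q n)) \<le> (\<Sum>n\<in>A. 1)"
          using norm that by (intro sum_norm_le) (auto simp: norm_mult intro!: mult_le_one)
        with True D show ?thesis by simp
      qed (use orth that in simp)
      moreover have "norm (\<theta> p * cnj (\<theta> q)) \<le> 1"
        using \<theta> by (simp add: norm_mult mult_le_one)
      ultimately show ?thesis
        using mult_mono[of "norm (\<theta> p * cnj (\<theta> q))" 1] by (simp add: norm_mult)
    qed
    have "(\<Sum>n\<in>A. (norm (g n))\<^sup>2) = norm (complex_of_real (\<Sum>n\<in>A. (norm (g n))\<^sup>2))"
      by (simp only: norm_of_real abs_of_nonneg sum_nonneg zero_le_power2)
    also have "\<dots> \<le> (\<Sum>p\<in>B. \<Sum>q\<in>B. (if p = q then real (card A) else 0) + D)"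
      unfolding eq by (intro sum_norm_le pair)
    also have "\<dots> = real (card B) * (real (card A) + real (card B) * D)"
      using fin by (simp add: sum.distrib)
    finally show ?thesis .
  qed
  finally have "(real (card B) * V)\<^sup>2 \<le>
      (\<Sum>n\<in>A. (w n)\<^sup>2) * (real (card B) * (real (card A) + real (card B) * D))"
    by (simp add: mult_left_mono sum_nonneg)
  then have "real (card B) * (real (card B) * V\<^sup>2) \<le>
      real (card B) * ((\<Sum>n\<in>A. (w n)\<^sup>2) * (real (card A) + real (card B) * D))"
    by (simp add: power2_eq_square mult_ac)
  with b show ?thesis by simp
qed

section \<open>Factorisations into \<open>k\<close> factors\<close>

text \<open>The \<open>k\<close>-fold divisor function with all factors at most \<open>M\<close>.
  These are the coefficients that appear when a sum of length \<open>M\<close> is raised to the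
  power \<open>k\<close>; extensional functions make each ordered factorisation count once.\<close>

definition product_count :: "nat \<Rightarrow> nat \<Rightarrow> nat \<Rightarrow> nat" where
  "product_count k M n =
     card {g \<in> PiE {..<k} (\<lambda>_. {1..M}). (\<Prod>i<k. g i) = n}"

lemma prod_PiE_range:
  fixes M :: nat
  assumes "g \<in> PiE {..<k} (\<lambda>_. {1..M})"
  shows "(\<Prod>i<k. g i) \<in> {1..M ^ k}"
proof -
  have g: "g i \<in> {1..M}" if "i < k" for i using assms that by (auto simp: PiE_iff)
  have "(\<Prod>i<k. g i) \<le> (\<Prod>i<k. M)" by (rule prod_mono) (use g in auto)
  moreover have "(\<Prod>i<k. g i) > 0" using g by (intro prod_pos) force
  ultimately show ?thesis by (simp add: Suc_le_eq del: prod_pos_nat_iff)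
qed

text \<open>Tuples are grouped by their product. A multiplicative \<open>h\<close> gives the
  expansion of a \<open>k\<close>-th power; the constant 1 gives the total weight
  \<open>M ^ k\<close>.\<close>

lemma sum_product_count:
  fixes h :: "nat \<Rightarrow> 'a :: comm_semiring_1"
  shows "(\<Sum>n=1..M ^ k. of_nat (product_count k M n) * h n) =
    (\<Sum>g\<in>PiE {..<k} (\<lambda>_. {1..M}). h (\<Prod>i<k. g i))"
proof -
  have "(\<Sum>g\<in>PiE {..<k} (\<lambda>_. {1..M}). h (\<Prod>i<k. g i)) =
      (\<Sum>n=1..M ^ k. \<Sum>g | g \<in> PiE {..<k} (\<lambda>_. {1..M}) \<and> (\<Prod>i<k. g i) = n. h (\<Prod>i<k. g i))"
    by (rule sum.group[symmetric]) (use prod_PiE_range in \<open>blast intro: finite_PiE\<close>)+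
  also have "\<dots> = (\<Sum>n=1..M ^ k. of_nat (product_count k M n) * h n)"
    by (simp add: product_count_def)
  finally show ?thesis by simp
qed

lemma power_sum_product_count:
  fixes \<psi> :: "nat \<Rightarrow> 'a :: comm_semiring_1"
  assumes mult: "\<And>x y. \<psi> (x * y) = \<psi> x * \<psi> y" and one: "\<psi> 1 = 1"
  shows "(\<Sum>n=1..M. \<psi> n) ^ k = (\<Sum>n=1..M ^ k. of_nat (product_count k M n) * \<psi> n)"
proof -
  have prod: "\<psi> (\<Prod>i<k. g i) = (\<Prod>i<k. \<psi> (g i))" for g
    using one by (induction k) (auto simp: mult)
  have "(\<Sum>n=1..M. \<psi> n) ^ k = (\<Prod>i<k. \<Sum>n=1..M. \<psi> n)" by simp
  also have "\<dots> = (\<Sum>g\<in>PiE {..<k} (\<lambda>_. {1..M}). \<Prod>i<k. \<psi> (g i))"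
    by (rule prod_sum_PiE) auto
  finally show ?thesis by (simp only: sum_product_count prod)
qed

text \<open>Each of the \<open>k\<close> factors is a divisor of \<open>n\<close>.\<close>

lemma product_count_le_card_divisors:
  assumes "n > 0"
  shows "product_count k M n \<le> card {d. d dvd n} ^ k"
proof -
  have "{g \<in> PiE {..<k} (\<lambda>_. {1..M}). (\<Prod>i<k. g i) = n} \<subseteq> PiE {..<k} (\<lambda>_. {d. d dvd n})"
    by (auto simp: PiE_def Pi_def)
  then have "product_count k M n \<le> card (PiE {..<k} (\<lambda>_. {d. d dvd n}))"
    unfolding product_count_def by (rule card_mono[rotated]) (use assms in \<open>auto intro!: finite_PiE\<close>)
  then show ?thesis by (simp add: card_PiE)
qed

text \<open>One factor of each square is replaced by \<open>R\<close>; the other factors add up to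
  the number of all tuples.\<close>

lemma sum_product_count_squared_le:
  assumes "\<And>n. n \<in> {1..M ^ k} \<Longrightarrow> real (product_count k M n) \<le> R"
  shows "(\<Sum>n=1..M ^ k. (real (product_count k M n))\<^sup>2) \<le> R * real M ^ k"
proof -
  have "(\<Sum>n=1..M ^ k. (real (product_count k M n))\<^sup>2) \<le>
      (\<Sum>n=1..M ^ k. R * (real (product_count k M n) * 1))"
    using assms by (intro sum_mono) (auto simp: power2_eq_square intro: mult_right_mono)
  also have "\<dots> = R * real M ^ k"
    unfolding sum_distrib_left[symmetric]
    using sum_product_count[of k M "\<lambda>_. 1 :: real"] by (simp add: card_PiE)
  finally show ?thesis .
qed

section \<open>Fermat quotients as characters modulo \<open>p\<^sup>2\<close>\<close>

definition additive_char :: "nat \<Rightarrow> int \<Rightarrow> complex" where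
  "additive_char p x = exp (2 * of_real pi * \<i> * of_int x / of_nat p)"

lemma additive_char_add: "additive_char p (x + y) = additive_char p x * additive_char p y"
  by (simp add: additive_char_def exp_add[symmetric] ring_distribs add_divide_distrib)

lemma norm_additive_char [simp]: "norm (additive_char p x) = 1"
  by (simp add: additive_char_def)

lemma additive_char_eq_1_iff:
  assumes "p > 0"
  shows "additive_char p x = 1 \<longleftrightarrow> int p dvd x"
proof -
  have "additive_char p x = 1 \<longleftrightarrow> (\<exists>n::int. 2 * pi * real_of_int x / real p = real_of_int (2 * n) * pi)"
    by (simp add: additive_char_def exp_eq_1)
  also have "\<dots> \<longleftrightarrow> (\<exists>n::int. real_of_int x = real_of_int (int p * n))"
    using assms by (simp add: field_simps)
  also have "\<dots> \<longleftrightarrow> int p dvd x" by (simp only: of_int_eq_iff dvd_def)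
  finally show ?thesis .
qed

lemma additive_char_cong:
  assumes "p > 0" "[x = y] (mod int p)"
  shows "additive_char p x = additive_char p y"
proof -
  have "additive_char p (x - y) = 1"
    using assms by (simp add: additive_char_eq_1_iff cong_iff_dvd_diff)
  then show ?thesis using additive_char_add[of p "x - y" y] by simp
qed

text \<open>Write \<open>w ^ (p - 1) = 1 + p * F w\<close>. In the product of two such expressions
  the cross term carries \<open>p * p\<close>, so \<open>F\<close> is additive modulo
  \<open>p\<close>, like a logarithm.\<close>

lemma fermat_quotient_mult:
  assumes "prime p" "coprime u (int p)" "coprime v (int p)"
  shows "[fermat_quotient p (u * v) = fermat_quotient p u + fermat_quotient p v] (mod int p)"
proof -
  have p: "p > 0" using assms(1) by (rule prime_gt_0_nat)
  define F where "F w = (w ^ (p - 1) - 1) div int p" for w :: int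
  have F: "w ^ (p - 1) = 1 + int p * F w" if "coprime w (int p)" for w
    using fermat_quotient_div_exact[OF assms(1) that] by (simp add: F_def)
  have "1 + int p * F (u * v) = (1 + int p * F u) * (1 + int p * F v)"
    using assms by (simp add: F[symmetric] power_mult_distrib)
  then have "int p * F (u * v) = int p * (F u + F v + int p * (F u * F v))"
    by (simp add: algebra_simps)
  then have "F (u * v) = F u + F v + int p * (F u * F v)" using p by simp
  then have "[F (u * v) = F u + F v] (mod int p)" by (simp add: cong_def)
  then show ?thesis
    using p by (simp add: fermat_quotient_eq_mod F_def cong_def mod_add_eq)
qed

text \<open>The number \<open>u ^ (p - 1) - 1\<close> modulo \<open>p ^ 2\<close> depends only on
  \<open>u\<close> modulo \<open>p ^ 2\<close>; cancelling its factor \<open>p\<close> leaves a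
  congruence modulo \<open>p\<close>.\<close>

lemma fermat_quotient_cong:
  assumes "prime p" "coprime u (int p)" "coprime v (int p)" "[u = v] (mod int (p ^ 2))"
  shows "fermat_quotient p u = fermat_quotient p v"
proof -
  have p: "p > 0" using assms(1) by (rule prime_gt_0_nat)
  have "[u ^ (p - 1) - 1 = v ^ (p - 1) - 1] (mod int (p ^ 2))"
    using assms(4) by (intro cong_diff cong_pow) auto
  then have "[int p * ((u ^ (p - 1) - 1) div int p) = int p * ((v ^ (p - 1) - 1) div int p)]
      (mod int p * int p)"
    using assms(1-3) by (simp only: fermat_quotient_div_exact power2_eq_square of_nat_mult)
  then have "[(u ^ (p - 1) - 1) div int p = (v ^ (p - 1) - 1) div int p] (mod int p)"
    using p by (simp add: cong_def mult_mod_right[symmetric])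
  then show ?thesis using p by (simp add: fermat_quotient_eq_mod cong_def)
qed

lemma fermat_quotient_1: "p > 0 \<Longrightarrow> fermat_quotient p 1 = 0"
  by (simp add: fermat_quotient_eq_mod)

lemma power_one_plus_cong: "[(1 + x) ^ n = 1 + int n * x] (mod x\<^sup>2)"
proof (induction n)
  case (Suc n)
  have "[(1 + x) * (1 + x) ^ n = (1 + x) * (1 + int n * x)] (mod x\<^sup>2)"
    by (rule cong_mult[OF cong_refl Suc])
  also have "(1 + x) * (1 + int n * x) = 1 + int (Suc n) * x + x\<^sup>2 * int n"
    by (simp add: algebra_simps power2_eq_square)
  also have "[\<dots> = 1 + int (Suc n) * x] (mod x\<^sup>2)" by (simp add: cong_def)
  finally show ?case by simp
qed simp

text \<open>To first order \<open>(1 + p) ^ (p - 1)\<close> is \<open>1 + (p - 1) * p\<close> modulo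
  \<open>p ^ 2\<close>, so the quotient at \<open>p + 1\<close> is \<open>p - 1\<close>. This is the
  witness that the characters below are nontrivial.\<close>

lemma not_dvd_fermat_quotient_Suc:
  assumes "prime p"
  shows "\<not> int p dvd fermat_quotient p (int (Suc p))"
proof -
  have p: "p > 1" using assms by (rule prime_gt_1_nat)
  have cop: "coprime (1 + int p) (int p)"
    by (metis coprime_add_one_left add.commute)
  have "[(1 + int p) ^ (p - 1) - 1 = 1 + int (p - 1) * int p - 1] (mod (int p)\<^sup>2)"
    by (intro cong_diff power_one_plus_cong) auto
  then have "[int p * (((1 + int p) ^ (p - 1) - 1) div int p) = int p * int (p - 1)]
      (mod int p * int p)"
    using fermat_quotient_div_exact[OF assms, of "1 + int p"] cop
    by (simp add: power2_eq_square mult.commute)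
  then have "[((1 + int p) ^ (p - 1) - 1) div int p = int (p - 1)] (mod int p)"
    using p by (simp add: cong_def mult_mod_right[symmetric])
  then have "fermat_quotient p (int (Suc p)) = int (p - 1)"
    using p by (simp add: fermat_quotient_eq_mod cong_def del: of_nat_diff)
  then show ?thesis using p zdvd_not_zless[of "int (p - 1)" "int p"] by auto
qed

text \<open>The value 0 off the units makes this a Dirichlet character on all of \<open>nat\<close>,
  completely multiplicative and periodic modulo \<open>p\<^sup>2\<close>, and absorbs the
  coprimality condition of \<open>fermat_sum\<close>.\<close>

definition fermat_char :: "nat \<Rightarrow> int \<Rightarrow> nat \<Rightarrow> complex" where
  "fermat_char p a n =
     (if coprime n p then additive_char p (a * fermat_quotient p (int n)) else 0)"

lemma fermat_sum_eq: "fermat_sum p a M = (\<Sum>n=1..M. fermat_char p a n)"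
  unfolding fermat_sum_def
  by (rule sum.mono_neutral_cong_left) (auto simp: fermat_char_def additive_char_def mult.assoc)

lemma norm_fermat_char_le: "norm (fermat_char p a n) \<le> 1"
  by (simp add: fermat_char_def)

lemma fermat_char_1: "p > 0 \<Longrightarrow> fermat_char p a (Suc 0) = 1"
  by (simp add: fermat_char_def fermat_quotient_1 additive_char_def)

lemma fermat_char_mult:
  assumes "prime p"
  shows "fermat_char p a (m * n) = fermat_char p a m * fermat_char p a n"
proof (cases "coprime m p \<and> coprime n p")
  case True
  then have "[fermat_quotient p (int m * int n) =
      fermat_quotient p (int m) + fermat_quotient p (int n)] (mod int p)"
    using assms by (intro fermat_quotient_mult) auto
  then have "[a * fermat_quotient p (int (m * n)) =
      a * fermat_quotient p (int m) + a * fermat_quotient p (int n)] (mod int p)"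
    unfolding distrib_left[symmetric] by (intro cong_mult) auto
  then show ?thesis
    using True assms
    by (simp add: fermat_char_def additive_char_add[symmetric] additive_char_cong prime_gt_0_nat)
qed (auto simp: fermat_char_def)

lemma fermat_char_cong:
  assumes "prime p" "[m = n] (mod p\<^sup>2)"
  shows "fermat_char p a m = fermat_char p a n"
proof -
  have "[m = n] (mod p)"
    using assms(2) by (rule cong_dvd_modulus_nat) (simp add: power2_eq_square)
  then have "coprime m p \<longleftrightarrow> coprime n p"
    by (metis cong_imp_coprime cong_sym)
  moreover have "[int m = int n] (mod int (p\<^sup>2))"
    using assms(2) by (simp only: cong_int_iff)
  ultimately show ?thesis
    using fermat_quotient_cong[of p "int m" "int n"] assms(1) by (simp add: fermat_char_def)
qed

lemma fermat_char_nontrivial: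
  assumes "prime p" "coprime a (int p)"
  shows "fermat_char p a (Suc p) \<noteq> 1"
proof -
  have "\<not> int p dvd a * fermat_quotient p (int (Suc p))"
    using assms not_dvd_fermat_quotient_Suc[OF assms(1)]
    by (simp add: coprime_dvd_mult_right_iff coprime_commute)
  moreover have "coprime (Suc p) p" by simp
  ultimately show ?thesis
    using assms by (simp add: fermat_char_def additive_char_eq_1_iff prime_gt_0_nat del: of_nat_Suc)
qed

text \<open>By the Chinese remainder theorem some \<open>u\<close> is \<open>p + 1\<close> modulo
  \<open>p\<^sup>2\<close> and 1 modulo \<open>q\<^sup>2\<close>. There the first character differs
  from 1 and the second equals 1, so the product is a nontrivial character modulo
  \<open>p\<^sup>2 * q\<^sup>2\<close>.\<close>

lemma fermat_char_product_sum_bound: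
  assumes p: "prime p" and q: "prime q" and neq: "p \<noteq> q" and a: "coprime a (int p)"
  shows "norm (\<Sum>n=1..X. fermat_char p a n * cnj (fermat_char q b n)) \<le> real (p\<^sup>2 * q\<^sup>2)"
proof -
  have pq: "coprime (p\<^sup>2) (q\<^sup>2)" using p q neq by (simp add: primes_coprime)
  obtain u where u: "[u = Suc p] (mod p\<^sup>2)" "[u = 1] (mod q\<^sup>2)"
    using binary_chinese_remainder_nat[OF pq] by blast
  have up: "fermat_char p a u \<noteq> 1"
    using fermat_char_cong[OF p u(1)] fermat_char_nontrivial[OF p a] by simp
  have uq: "fermat_char q b u = 1"
    using fermat_char_cong[OF q u(2)] q by (simp add: fermat_char_1 prime_gt_0_nat)
  have "coprime u (p\<^sup>2)" using u(1)
    by (rule cong_imp_coprime[OF cong_sym]) simp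
  moreover have "coprime u (q\<^sup>2)" using u(2)
    by (rule cong_imp_coprime[OF cong_sym]) simp
  ultimately have cop: "coprime u (p\<^sup>2 * q\<^sup>2)" by simp
  show ?thesis
  proof (rule nontrivial_character_sum_bound[OF _ _ cop])
    show "fermat_char p a (x * y) * cnj (fermat_char q b (x * y)) =
        fermat_char p a x * cnj (fermat_char q b x) * (fermat_char p a y * cnj (fermat_char q b y))"
      for x y using p q by (simp add: fermat_char_mult mult_ac)
    show "fermat_char p a (n + p\<^sup>2 * q\<^sup>2) * cnj (fermat_char q b (n + p\<^sup>2 * q\<^sup>2)) =
        fermat_char p a n * cnj (fermat_char q b n)" for n
      using fermat_char_cong[OF p, of "n + p\<^sup>2 * q\<^sup>2" n] fermat_char_cong[OF q, of "n + p\<^sup>2 * q\<^sup>2" n]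
      by (simp add: cong_def)
    show "fermat_char p a u * cnj (fermat_char q b u) \<noteq> 1" using up uq by simp
    show "p\<^sup>2 * q\<^sup>2 > 0" using p q by (simp add: prime_gt_0_nat)
    show "norm (fermat_char p a n * cnj (fermat_char q b n)) \<le> 1" for n
      by (simp add: norm_mult mult_le_one norm_fermat_char_le)
  qed
qed

section \<open>Counting primes with large sums\<close>

text \<open>Duality is applied on \<open>{1..M ^ k}\<close> with weights
  \<open>product_count k M\<close> and threshold \<open>(M / W) ^ k\<close>. The condition
  \<open>long\<close> makes the off-diagonal contribution at most half of the left side, where it is
  absorbed.\<close>

lemma large_fermat_sums_card_le:
  fixes W R :: real
  assumes fin: "finite B"
    and B: "\<And>p. p \<in> B \<Longrightarrow> prime p \<and> p \<le> 2 * P \<and> coprime (a p) (int p)"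
    and large: "\<And>p. p \<in> B \<Longrightarrow> real M / W \<le> norm (fermat_sum p (a p) M)"
    and count: "\<And>n. n \<in> {1..M ^ k} \<Longrightarrow> real (product_count k M n) \<le> R"
    and W: "W > 0" and M: "M > 0"
    and long: "32 * (W ^ (2 * k) * R) * real P ^ 4 \<le> real M ^ k"
  shows "real (card B) \<le> 2 * (W ^ (2 * k) * R)"
proof -
  define X D b G where "X = real M ^ k" and "D = 16 * real P ^ 4" and "b = real (card B)"
    and "G = W ^ (2 * k) * R"
  have X: "X > 0" using M by (simp add: X_def)
  have b0: "b \<ge> 0" by (simp add: b_def)
  have "real (card B) * ((real M / W) ^ k)\<^sup>2 \<le>
      (\<Sum>n=1..M ^ k. (real (product_count k M n))\<^sup>2) * (real (card {1..M ^ k}) + real (card B) * D)"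
  proof (rule duality_large_values[where \<psi> = "\<lambda>p. fermat_char p (a p)"])
    fix p q assume pq: "p \<in> B" "q \<in> B" "p \<noteq> q"
    have "norm (\<Sum>n=1..M ^ k. fermat_char p (a p) n * cnj (fermat_char q (a q) n)) \<le> real (p\<^sup>2 * q\<^sup>2)"
      using pq B by (intro fermat_char_product_sum_bound) auto
    also have "\<dots> \<le> real ((2 * P)\<^sup>2 * (2 * P)\<^sup>2)"
      using pq B by (intro of_nat_mono mult_mono power_mono) auto
    also have "\<dots> = D" by (simp add: D_def power_mult_distrib power2_eq_square numeral_eq_Suc)
    finally show "norm (\<Sum>n=1..M ^ k. fermat_char p (a p) n * cnj (fermat_char q (a q) n)) \<le> D" .
  next
    fix p assume p: "p \<in> B"
    then have "prime p" using B by blast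
    then have "(\<Sum>n=1..M. fermat_char p (a p) n) ^ k =
        (\<Sum>n=1..M ^ k. of_nat (product_count k M n) * fermat_char p (a p) n)"
      by (intro power_sum_product_count) (auto simp: fermat_char_mult fermat_char_1 prime_gt_0_nat)
    then have "norm (fermat_sum p (a p) M) ^ k =
        norm (\<Sum>n=1..M ^ k. complex_of_real (real (product_count k M n)) * fermat_char p (a p) n)"
      by (simp add: fermat_sum_eq flip: norm_power)
    moreover have "(real M / W) ^ k \<le> norm (fermat_sum p (a p) M) ^ k"
      using large[OF p] W by (intro power_mono) auto
    ultimately show "(real M / W) ^ k \<le>
        norm (\<Sum>n=1..M ^ k. complex_of_real (real (product_count k M n)) * fermat_char p (a p) n)"
      by simp
  qed (use fin W in \<open>auto simp: norm_fermat_char_le D_def\<close>)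
  also have "\<dots> \<le> (R * real M ^ k) * (real (card {1..M ^ k}) + real (card B) * D)"
    by (intro mult_right_mono sum_product_count_squared_le count) (auto simp: D_def)
  finally have "b * (X\<^sup>2 / W ^ (2 * k)) \<le> R * X * (X + b * D)"
    by (simp add: X_def b_def power_divide power_mult[symmetric] mult.commute)
  then have "b * X\<^sup>2 \<le> G * X * (X + b * D)"
    using W by (simp add: G_def divide_le_eq mult_ac)
  then have "X * (b * X) \<le> X * (G * X + b * (G * D))"
    by (simp add: algebra_simps power2_eq_square)
  then have "b * X \<le> G * X + b * (G * D)" using X by simp
  \<comment> \<open>The 32 in \<open>long\<close> is twice the 16 in \<open>D\<close>, which comes
    from \<open>(2 * P) ^ 4\<close>.\<close>
  also have "b * (G * D) \<le> b * (X / 2)"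
    using long b0 by (intro mult_left_mono) (auto simp: G_def D_def X_def)
  finally have "X * b \<le> X * (2 * G)" by (simp add: algebra_simps)
  then show ?thesis using X by (simp add: b_def G_def)
qed

lemma norm_fermat_sum_diff_le:
  assumes "M \<le> M'"
  shows "norm (fermat_sum p a M') \<le> norm (fermat_sum p a M) + real (M' - M)"
proof -
  have "(\<Sum>n=1..M'. fermat_char p a n) =
      (\<Sum>n=1..M. fermat_char p a n) + (\<Sum>n=M+1..M'. fermat_char p a n)"
    using sum.ub_add_nat[of 1 M "fermat_char p a" "M' - M"] assms by simp
  moreover have "norm (\<Sum>n=M+1..M'. fermat_char p a n) \<le> (\<Sum>n=M+1..M'. 1)"
    by (intro sum_norm_le norm_fermat_char_le)
  ultimately show ?thesis
    using norm_triangle_ineq[of "\<Sum>n=1..M. fermat_char p a n" "\<Sum>n=M+1..M'. fermat_char p a n"]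
    by (simp add: fermat_sum_eq)
qed

text \<open>The lengths \<open>Np p\<close> are rounded down to multiples of a fixed \<open>L\<close>, which costs at most half of
  each sum; only \<open>O(t)\<close> different lengths remain.\<close>

lemma large_fermat_sums_varying_length_card_le:
  fixes t R :: real
  assumes fin: "finite B"
    and B: "\<And>p. p \<in> B \<Longrightarrow> prime p \<and> p \<le> 2 * P \<and> coprime (a p) (int p)"
    and Np: "\<And>p. p \<in> B \<Longrightarrow> N < Np p \<and> Np p \<le> 2 * N"
    and large: "\<And>p. p \<in> B \<Longrightarrow> real N / (2 * t) \<le> norm (fermat_sum p (a p) (Np p))"
    and count: "\<And>M n. M \<le> 2 * N \<Longrightarrow> n \<in> {1..M ^ k} \<Longrightarrow> real (product_count k M n) \<le> R"
    and t: "t \<ge> 1" and N: "real N \<ge> 4 * t" and R: "R \<ge> 0"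
    and long: "32 * ((8 * t) ^ (2 * k) * R) * real P ^ 4 \<le> (real N / 2) ^ k"
  shows "real (card B) \<le> 34 * t * ((8 * t) ^ (2 * k) * R)"
proof -
  \<comment> \<open>\<open>y\<close> is half of the assumed lower bound \<open>N / (2 * t)\<close>.
    Rounding a length down to a multiple of \<open>L\<close>, the integer part of \<open>y\<close>,
    changes the sum by at most \<open>y\<close>, so at least \<open>y\<close> survives.
    \<open>J\<close> is the largest possible quotient of a length by \<open>L\<close>.\<close>
  define y L J where "y = real N / (4 * t)" and "L = nat \<lfloor>y\<rfloor>" and "J = (2 * N) div L"
  define G where "G = (8 * t) ^ (2 * k) * R"
  have G: "G \<ge> 0" using t R by (simp add: G_def)
  have y: "y \<ge> 1" using N t by (simp add: y_def le_divide_eq)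
  have L1: "L \<ge> 1" using y by (simp add: L_def le_nat_floor)
  have Ly: "real L \<le> y" "y \<le> 2 * real L" using y L1 unfolding L_def by linarith+
  have Nt: "real N = 4 * t * y" using t by (simp add: y_def)
  have yN: "y \<le> real N / 4"
    unfolding y_def using t by (intro divide_left_mono) auto
  have J: "real J \<le> 16 * t"
  proof -
    have "real J \<le> real (2 * N) / real L" unfolding J_def by (rule of_nat_div_le_of_nat)
    also have "\<dots> \<le> 16 * t" using L1 Ly Nt t
      using mult_left_mono[of y "2 * real L" "8 * t"] by (simp add: divide_le_eq)
    finally show ?thesis .
  qed
  have split: "card B \<le> (\<Sum>j\<le>J. card {p \<in> B. Np p div L = j})"
  proof -
    have "B = (\<Union>j\<le>J. {p \<in> B. Np p div L = j})"
      using Np by (auto simp: J_def intro!: div_le_mono)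
    then show ?thesis
      using card_UN_le[of "{..J}" "\<lambda>j. {p \<in> B. Np p div L = j}"] by auto
  qed
  have part: "real (card {p \<in> B. Np p div L = j}) \<le> 2 * G" for j
  proof (cases "{p \<in> B. Np p div L = j} = {}")
    case False
    define M where "M = j * L"
    have M: "M \<le> Np p" "real (Np p - M) \<le> y" if "p \<in> B" "Np p div L = j" for p
    proof -
      have "Np p = M + Np p mod L" using div_mult_mod_eq[of "Np p" L] that by (simp add: M_def)
      moreover have "Np p mod L < L" using L1 by simp
      ultimately have "M \<le> Np p" "Np p - M \<le> L" by linarith+
      then show "M \<le> Np p" "real (Np p - M) \<le> y" using Ly(1) by linarith+
    qed
    obtain p0 where p0: "p0 \<in> B" "Np p0 div L = j" using False by blast
    \<comment> \<open>Rounding loses at most \<open>N / 4\<close> from a length above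
      \<open>N\<close>, so the common length stays above \<open>N / 2\<close>, as the hypothesis
      \<open>long\<close> presupposes.\<close>
    have M2N: "M \<le> 2 * N" and NM: "real N / 2 \<le> real M"
      using M[OF p0] Np[OF p0(1)] yN by linarith+
    show ?thesis unfolding G_def
    proof (rule large_fermat_sums_card_le[where M = M and a = a and P = P])
      fix p assume p: "p \<in> {p \<in> B. Np p div L = j}"
      have "real N / (2 * t) = 2 * y" using t by (simp add: y_def)
      then have "2 * y \<le> norm (fermat_sum p (a p) (Np p))" using large[of p] p by simp
      also have "\<dots> \<le> norm (fermat_sum p (a p) M) + y"
        using norm_fermat_sum_diff_le[of M "Np p" p "a p"] M[of p] p by auto
      finally have "y \<le> norm (fermat_sum p (a p) M)" by simp
      \<comment> \<open>This explains the loss \<open>W = 8 * t\<close>: the surviving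
        \<open>y\<close> is at least \<open>M / (8 * t)\<close>.\<close>
      moreover have "real M \<le> 8 * t * y" using M2N Nt by linarith
      then have "real M / (8 * t) \<le> y" using t by (simp add: divide_le_eq mult_ac)
      ultimately show "real M / (8 * t) \<le> norm (fermat_sum p (a p) M)" by simp
    next
      have "(real N / 2) ^ k \<le> real M ^ k" using NM by (intro power_mono) auto
      then show "32 * ((8 * t) ^ (2 * k) * R) * real P ^ 4 \<le> real M ^ k" using long by simp
    next
      show "M > 0" using NM N t by linarith
    qed (use fin B count M2N t in auto)
  next
    case True
    with G show ?thesis unfolding True by simp
  qed
  have "real (card B) \<le> (\<Sum>j\<le>J. real (card {p \<in> B. Np p div L = j}))"
    using split by (simp only: of_nat_le_iff flip: of_nat_sum)
  also have "\<dots> \<le> (\<Sum>j\<le>J. 2 * G)" by (intro sum_mono part)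
  also have "\<dots> = (real J + 1) * (2 * G)" by simp
  \<comment> \<open>There are \<open>J + 1\<close> possible quotients, at most
    \<open>16 * t + 1\<close>, and \<open>t\<close> is at least 1.\<close>
  also have "\<dots> \<le> (17 * t) * (2 * G)"
    using J t G by (intro mult_right_mono) auto
  finally show ?thesis by (simp add: G_def)
qed

text \<open>The exponent has two factors \<open>k\<close>: one from the \<open>k\<close> factors of
  \<open>n\<close>, the other from \<open>n\<close> being at most \<open>M ^ k\<close>.\<close>

lemma product_count_le_powr:
  assumes C: "C \<ge> 0" "\<And>n::nat. n > 0 \<Longrightarrow> real (card {d. d dvd n}) \<le> C * real n powr \<eta>"
    and \<eta>: "\<eta> \<ge> 0" and k: "k > 0" and n: "n \<in> {1..M ^ k}"
  shows "real (product_count k M n) \<le> C ^ k * real M powr (\<eta> * real (k * k))"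
proof -
  have M: "M > 0" using n k by (cases "M = 0"; cases k) auto
  have "real (product_count k M n) \<le> real (card {d. d dvd n}) ^ k"
    using product_count_le_card_divisors[of n k M] n by (simp flip: of_nat_power)
  also have "\<dots> \<le> (C * real n powr \<eta>) ^ k"
    using C(2)[of n] n by (intro power_mono) auto
  also have "\<dots> \<le> (C * real (M ^ k) powr \<eta>) ^ k"
    using C(1) n \<eta> by (intro power_mono mult_left_mono powr_mono2) auto
  also have "\<dots> = C ^ k * real M powr (\<eta> * real (k * k))"
    using M by (auto simp: power_mult_distrib powr_realpow[symmetric] powr_powr powr_power mult_ac)
  finally show ?thesis .
qed

section \<open>Choice of parameters and conclusion\<close>

theorem corollary9:
  fixes \<epsilon> \<delta> :: real
  assumes "\<epsilon> > 0" and "\<delta> > 0"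
  shows "\<exists>\<kappa>>0. \<exists>C :: real. \<exists>K :: nat. \<forall>P N :: nat. \<forall>Np :: nat \<Rightarrow> nat.
           K \<le> P \<and> K \<le> N \<and> 0 < P \<and> 0 < N \<and>
           real P powr \<epsilon> \<le> real N \<and> N \<le> P ^ 2 \<and>
           (\<forall>p. prime p \<and> P < p \<and> p \<le> 2 * P \<longrightarrow> N < Np p \<and> Np p \<le> 2 * N) \<longrightarrow>
           real (card {p. prime p \<and> P < p \<and> p \<le> 2 * P \<and>
                          \<not> max_fermat_sum p (Np p) \<le> real (Np p) * real p powr (- \<kappa>)})
             \<le> C * real P powr (1 / 2 + \<delta>)"
proof -
  \<comment> \<open>This gives \<open>N ^ k\<close> at least \<open>P ^ 6\<close>, which exceeds the
    period bound of order \<open>P ^ 4\<close> by a margin \<open>P ^ 2\<close> for all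
    losses.\<close>
  define k where "k = Suc (nat \<lceil>6 / \<epsilon>\<rceil>)"
  have k: "\<epsilon> * real k \<ge> 6"
  proof -
    have "6 / \<epsilon> \<le> real k" unfolding k_def by linarith
    then show ?thesis using assms(1) by (simp add: divide_le_eq mult.commute)
  qed
  \<comment> \<open>With \<open>t = P powr \<kappa>\<close>, the first bound gives
    \<open>t ^ 2\<close> at most \<open>N\<close>, the second \<open>t ^ (2 * k + 2)\<close> at most
    \<open>P powr (1 / 2)\<close>.\<close>
  define \<kappa> where "\<kappa> = min (\<epsilon> / 2) (1 / (4 * real (k + 1)))"
  have \<kappa>: "\<kappa> > 0" "2 * \<kappa> \<le> \<epsilon>" "\<kappa> * real (2 * k + 2) \<le> 1 / 2" "\<kappa> \<le> 1"
  proof -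
    show "\<kappa> > 0" "2 * \<kappa> \<le> \<epsilon>" using assms(1) by (auto simp: \<kappa>_def)
    have "\<kappa> \<le> 1 / (4 * real (k + 1))" by (simp add: \<kappa>_def)
    then show "\<kappa> * real (2 * k + 2) \<le> 1 / 2" by (simp add: field_simps)
    have "1 / (4 * real (k + 1)) \<le> 1" by (simp add: field_simps)
    then show "\<kappa> \<le> 1" unfolding \<kappa>_def by linarith
  qed
  have k0: "k > 0" by (simp add: k_def)
  \<comment> \<open>All lengths are at most \<open>2 * N\<close>, hence at most
    \<open>P ^ 3\<close>; so \<open>M powr (\<eta> * k * k)\<close> is at most
    \<open>P powr \<kappa>\<close>, and the weights cost a single factor \<open>t\<close> up to a
    constant.\<close>
  define \<eta> where "\<eta> = \<kappa> / (3 * real (k * k))"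
  have \<eta>: "\<eta> > 0" "3 * (\<eta> * real (k * k)) = \<kappa>" using \<kappa>(1) k0 by (auto simp: \<eta>_def)
  obtain C where C: "C \<ge> 1" "\<And>n::nat. n > 0 \<Longrightarrow> real (card {d. d dvd n}) \<le> C * real n powr \<eta>"
    using card_divisors_le_powr[OF \<eta>(1)] by blast
  \<comment> \<open>\<open>A\<close> collects the constants in \<open>(8 * t) ^ (2 * k) * R\<close>.
    Next, \<open>c\<close> also includes the 32 of the length condition and the \<open>2 ^ k\<close>
    from halving \<open>N\<close>, and \<open>K\<close> is large enough that \<open>t\<close> is at
    least \<open>c\<close>.\<close>
  define A where "A = 64 ^ k * C ^ k"
  have A: "A \<ge> 1" using C(1) by (auto simp: A_def intro!: mult_ge1_I)
  define c where "c = 32 * A * 2 ^ k"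
  have c: "c \<ge> 4"
    unfolding c_def using A mult_mono[of 32 "32 * A" 1 "2 ^ k"] by simp
  define K where "K = nat \<lceil>c powr (1 / \<kappa>)\<rceil> + 2"
  show ?thesis
  proof (rule exI[of _ \<kappa>], rule conjI[OF \<kappa>(1)], rule exI[of _ "34 * A"], rule exI[of _ K],
      intro allI impI)
    fix P N :: nat and Np :: "nat \<Rightarrow> nat"
    assume hyp: "K \<le> P \<and> K \<le> N \<and> 0 < P \<and> 0 < N \<and>
           real P powr \<epsilon> \<le> real N \<and> N \<le> P ^ 2 \<and>
           (\<forall>p. prime p \<and> P < p \<and> p \<le> 2 * P \<longrightarrow> N < Np p \<and> Np p \<le> 2 * N)"
    define t where "t = real P powr \<kappa>"
    have P2: "P \<ge> 2" using hyp by (simp add: K_def)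
    have ct: "c \<le> t"
    proof -
      have "c powr (1 / \<kappa>) \<le> real P" using hyp unfolding K_def by linarith
      then have "(c powr (1 / \<kappa>)) powr \<kappa> \<le> t"
        unfolding t_def using \<kappa>(1) by (intro powr_mono2) auto
      then show ?thesis using \<kappa>(1) c by (simp add: powr_powr)
    qed
    then have t4: "t \<ge> 4" using c by simp
    have tpow: "t ^ m = real P powr (\<kappa> * real m)" for m
      using P2 by (simp add: t_def powr_realpow[symmetric] powr_powr)
    have t2k: "t ^ (2 * k + 2) \<le> real P powr (1 / 2)"
      unfolding tpow using \<kappa>(3) P2 by (intro powr_mono) auto
    have N4: "real N \<ge> 4 * t"
    proof -
      have "4 * t \<le> t ^ 2" using t4 by (simp add: power2_eq_square)
      also have "\<dots> \<le> real P powr \<epsilon>"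
        unfolding tpow using \<kappa>(2) P2 by (intro powr_mono) auto
      finally show ?thesis using hyp by simp
    qed
    define R where "R = C ^ k * t"
    have G: "(8 * t) ^ (2 * k) * R = A * t ^ (2 * k + 1)"
      by (simp add: R_def A_def power_mult_distrib power_mult)
    have Nk: "real P ^ 6 \<le> real N ^ k"
    proof -
      have "real P ^ 6 = real P powr 6" using P2 by simp
      also have "\<dots> \<le> real P powr (\<epsilon> * real k)" using k P2 by (intro powr_mono) auto
      also have "\<dots> = (real P powr \<epsilon>) ^ k"
        using P2 by (simp add: powr_realpow[symmetric] powr_powr)
      also have "\<dots> \<le> real N ^ k" using hyp by (intro power_mono) auto
      finally show ?thesis .
    qed
    have long: "32 * ((8 * t) ^ (2 * k) * R) * real P ^ 4 \<le> (real N / 2) ^ k"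
    proof -
      have "c * t ^ (2 * k + 1) \<le> t * t ^ (2 * k + 1)"
        using ct t4 by (intro mult_right_mono) auto
      also have "\<dots> \<le> real P powr (1 / 2)" using t2k by simp
      also have "\<dots> \<le> real P powr 2" using P2 by (intro powr_mono) auto
      finally have "c * t ^ (2 * k + 1) * real P ^ 4 \<le> real P ^ 2 * real P ^ 4"
        using P2 by (intro mult_right_mono) auto
      also have "\<dots> = real P ^ 6" by (simp flip: power_add)
      finally have "c * t ^ (2 * k + 1) * real P ^ 4 \<le> real N ^ k" using Nk by simp
      then show ?thesis unfolding G c_def by (simp add: power_divide field_simps)
    qed
    have count: "real (product_count k M n) \<le> R" if M: "M \<le> 2 * N" and n: "n \<in> {1..M ^ k}" for M n
    proof -
      have "M \<le> P ^ 3"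
      proof -
        have "M \<le> 2 * P ^ 2" using M hyp by linarith
        also have "\<dots> \<le> P * P ^ 2" using P2 by (intro mult_right_mono) auto
        finally show ?thesis by (simp add: power2_eq_square power3_eq_cube)
      qed
      then have "real M \<le> real P powr 3" using P2 by (simp flip: of_nat_power)
      then have "real M powr (\<eta> * real (k * k)) \<le> (real P powr 3) powr (\<eta> * real (k * k))"
        using \<eta>(1) by (intro powr_mono2) auto
      also have "\<dots> = t" by (simp only: powr_powr \<eta>(2) t_def)
      finally have "C ^ k * real M powr (\<eta> * real (k * k)) \<le> R"
        unfolding R_def using C(1) by (intro mult_left_mono) auto
      with product_count_le_powr[OF _ C(2) _ k0 n] C(1) \<eta>(1) show ?thesis by force
    qed
    define B where "B = {p. prime p \<and> P < p \<and> p \<le> 2 * P \<and>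
        \<not> max_fermat_sum p (Np p) \<le> real (Np p) * real p powr (- \<kappa>)}"
    have Bp: "prime p \<and> p \<le> 2 * P" "N < Np p \<and> Np p \<le> 2 * N" if "p \<in> B" for p
      using that hyp by (auto simp: B_def)
    \<comment> \<open>The maximum is attained at some \<open>a\<close>. The 2 in the denominator
      pays for replacing \<open>p\<close> by \<open>P\<close>: \<open>p powr \<kappa>\<close> is at
      most \<open>(2 * P) powr \<kappa>\<close>, hence at most \<open>2 * t\<close>.\<close>
    have "\<exists>a. coprime a (int p) \<and> real N / (2 * t) \<le> norm (fermat_sum p a (Np p))" if p: "p \<in> B" for p
    proof -
      have pp: "p > 0" using Bp[OF p] by (simp add: prime_gt_0_nat)
      have "max_fermat_sum p (Np p) \<in> (\<lambda>a. norm (fermat_sum p a (Np p))) ` {a :: int. coprime a (int p)}"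
        unfolding max_fermat_sum_def
        by (rule Max_in) (use finite_fermat_sum_values[OF pp] in \<open>auto intro: exI[of _ 1]\<close>)
      then obtain a where a: "coprime a (int p)" "max_fermat_sum p (Np p) = norm (fermat_sum p a (Np p))"
        by auto
      have "real p powr \<kappa> \<le> (2 * real P) powr \<kappa>"
        using Bp[OF p] \<kappa>(1) by (intro powr_mono2) auto
      also have "\<dots> = 2 powr \<kappa> * t" by (simp add: powr_mult t_def)
      also have "\<dots> \<le> 2 * t"
        using powr_mono[OF \<kappa>(4), of 2] t4 by (intro mult_right_mono) auto
      finally have "real N / (2 * t) \<le> real (Np p) / real p powr \<kappa>"
        using Bp[OF p] pp by (intro frac_le) auto
      also have "\<dots> = real (Np p) * real p powr (- \<kappa>)" by (simp add: powr_minus_divide)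
      also have "\<dots> \<le> max_fermat_sum p (Np p)" using p by (simp add: B_def)
      finally show ?thesis using a by auto
    qed
    then obtain a where a: "\<And>p. p \<in> B \<Longrightarrow>
        coprime (a p) (int p) \<and> real N / (2 * t) \<le> norm (fermat_sum p (a p) (Np p))"
      by metis
    have "finite B" by (rule finite_subset[of _ "{..2 * P}"]) (auto simp: B_def)
    then have "real (card B) \<le> 34 * t * ((8 * t) ^ (2 * k) * R)"
    proof (rule large_fermat_sums_varying_length_card_le[where a = a and P = P and N = N and Np = Np])
      show "R \<ge> 0" using C(1) t4 by (simp add: R_def)
    qed (use Bp a count N4 long t4 in auto)
    also have "\<dots> = 34 * A * t ^ (2 * k + 2)" unfolding G by (simp add: mult_ac)
    also have "\<dots> \<le> 34 * A * real P powr (1 / 2)"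
      using t2k A by (intro mult_left_mono) auto
    also have "\<dots> \<le> 34 * A * real P powr (1 / 2 + \<delta>)"
      using A assms(2) P2 by (intro mult_left_mono powr_mono) auto
    finally show "real (card {p. prime p \<and> P < p \<and> p \<le> 2 * P \<and>
        \<not> max_fermat_sum p (Np p) \<le> real (Np p) * real p powr (- \<kappa>)})
          \<le> 34 * A * real P powr (1 / 2 + \<delta>)"
      unfolding B_def .
  qed
qed

end
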